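(* The superalgebras $B_1$, $B_{2,\alpha}$ ($\alpha\in\mathbf{C}$) and $\widetilde{B_{2,-1}}$ are pairwise nonisomorphic; that is, no two distinct members of the family $\{B_1\}\cup\{B_{2,\alpha}:\alpha\in\mathbf{C}\}\cup\{\widetilde{B_{2,-1}}\}$ are isomorphic.
   Context: Isomorphisms are even bijective linear maps preserving the product. All superalgebras below live on the superspace with ordered basis $(x_1,x_2,x_3,x_4,y_1,y_2,y_3,y_4)$ ($x_i$ even, $y_j$ odd), and are given by left multiplication matrices $L(a)$, whose $j$-th column is the coordinate vector of $a\cdot(\text{$j$-th basis vector})$. Write $L(a)=\begin{pmatrix}P&Q\\R&S\end{pmatrix}$ with $4\times4$ blocks; for $a=x_i$, $Q=R=0$ and we list $P,S$; for $a=y_j$, $P=S=0$ and we list $Q,R$. Rows are separated by semicolons. $B_1$: $L(x_1)$: $P=[0,\tfrac12,-1,1;0,0,0,0;0,\tfrac12,0,0;0,\tfrac12,0,0]$, $S=0$. $L(x_2)$: $P=[\tfrac12,0,0,-\tfrac12;0,0,1,1;-\tfrac12,0,0,\tfrac12;\tfrac12,0,0,-\tfrac12]$, $S=0$. $L(x_3)$: $P=[1,0,1,-1;0,-1,0,0;0,0,0,1;0,0,1,0]$, $S=0$. $L(x_4)$: $P=[1,-\tfrac12,-1,-1;0,1,0,0;0,\tfrac12,1,0;0,-\tfrac12,0,1]$, $S=[2,0,0,0;-1,2,0,0;0,0,0,1;0,0,0,0]$. $L(y_1)$: $Q=[0,0,0,\tfrac14;0,0,0,0;0,0,0,-\tfrac14;0,0,0,\tfrac14]$,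 $R=[0,0,1,1;1,0,0,-1;0,0,0,0;0,0,0,0]$. $L(y_2)$: $Q=[0,0,0,-\tfrac12;0,0,0,0;0,0,0,0;0,0,0,0]$, $R=[0,1,0,0;0,0,-1,1;0,0,0,0;0,0,0,0]$. $L(y_3)$: $Q=[0,1,0,0;0,0,0,0;\tfrac12,0,0,0;\tfrac12,0,0,0]$, $R=[0,0,0,0;0,0,0,0;0,0,-1,1;0,-1,0,0]$. $L(y_4)$: $Q=[-\tfrac14,\tfrac12,0,0;1,0,0,0;\tfrac14,-\tfrac12,0,0;-\tfrac14,\tfrac12,0,0]$, $R=[0,0,0,0;0,0,0,0;-1,0,0,1;0,0,1,1]$. $B_{2,\alpha}$ ($\alpha\in\mathbf{C}$, $\beta=1+\alpha$, $\gamma=1-\alpha$): $L(x_1)$: $P=[0,0,-1,\beta;0,0,0,0;0,\beta/2,0,0;0,\tfrac12,0,0]$, $S=0$. $L(x_2)$: $P=[0,0,0,0;0,0,1,\gamma;-\gamma/2,0,0,0;\tfrac12,0,0,0]$, $S=0$. $L(x_3)$: $P=[1,0,0,0;0,-1,0,0;0,0,\alpha,\beta\gamma;0,0,1,-\alpha]$, $S=0$. $L(x_4)$: $P=[\beta,0,0,0;0,\gamma,0,0;0,0,\beta\gamma,-\alpha\beta\gamma;0,0,-\alpha,1+\alpha^2]$, $S=\mathrm{diag}(2-\alpha,2+\alpha,\alpha,-\alpha)$. $L(y_1)$: $Q=[0,0,0,0;0,0,0,\alpha\beta/4;0,0,-\alpha\gamma/4,0;0,0,\alpha/4,0]$, $R=[0,0,1,\gamma;1,0,0,0;0,0,0,0;0,0,0,0]$.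 $L(y_2)$: $Q=[0,0,-\alpha/2,0;0,0,0,0;0,0,0,-\alpha\beta/4;0,0,0,-\alpha/4]$, $R=[0,1,0,0;0,0,-1,\beta;0,0,0,0;0,0,0,0]$. $L(y_3)$: $Q=[0,1+\alpha/2,0,0;0,0,0,0;(\alpha\gamma+2)/4,0,0,0;(2-\alpha)/4,0,0,0]$, $R=[0,0,0,0;0,0,0,0;0,0,-1,\beta;0,-1,0,0]$. $L(y_4)$: $Q=[0,0,0,0;1-\alpha\beta/4,0,0,0;0,(\alpha\beta-2)/4,0,0;0,(\alpha+2)/4,0,0]$, $R=[0,0,0,0;0,0,0,0;-1,0,0,0;0,0,1,\gamma]$. $\widetilde{B_{2,-1}}$: $L(x_1)$: $P=[0,0,-1,0;0,0,0,0;0,0,0,0;0,\tfrac12,0,0]$, $S=[0,0,0,0;1,0,0,0;0,\tfrac12,0,1;-\tfrac32,0,0,0]$. $L(x_2)$: $P=[0,0,0,0;0,0,1,2;-1,0,0,0;\tfrac12,0,0,0]$, $S=[0,-1,0,-2;0,0,-2,0;0,0,0,0;0,0,3,0]$. $L(x_3)$: $P=[1,0,0,0;0,-1,0,0;0,0,-1,0;0,0,1,1]$, $S=\mathrm{diag}(-2,0,2,0)$. $L(x_4)$: $P=[0,0,0,0;0,2,0,0;0,0,0,0;0,0,1,2]$, $S=I_4$. $L(y_1)$: $Q=[0,0,0,0;0,\tfrac34,0,1;0,0,0,0;0,0,\tfrac34,0]$, $R=[0,0,-1,0;2,0,0,0;0,0,0,0;-\tfrac32,0,0,0]$. $L(y_2)$: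 $Q=[0,0,0,0;-\tfrac34,0,0,0;0,0,0,0;0,0,0,\tfrac14]$, $R=[0,0,0,0;0,0,-1,0;\tfrac12,0,0,0;0,0,0,0]$. $L(y_3)$: $Q=[0,1,0,1;0,0,0,0;\tfrac12,0,0,0;-\tfrac14,0,0,0]$, $R=[0,0,0,0;0,-2,0,0;0,0,1,2;0,2,0,0]$. $L(y_4)$: $Q=[0,0,-1,0;0,0,0,0;0,-\tfrac12,0,0;0,\tfrac14,0,0]$, $R=[0,-2,0,0;0,0,0,0;0,0,0,0;0,0,1,2]$. *)

theory Defs
  imports Complex_Main
begin

text \<open>Superspace C^{4|4} with ordered basis e_0..e_7 = (x1,x2,x3,x4,y1,y2,y3,y4);
 indices 0..3 even, 4..7 odd. A superalgebra is given by its list of 8 left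
 multiplication matrices: (A ! i) ! k ! j = coefficient of e_k in e_i * e_j
 (the j-th column of L(e_i) is the coordinate vector of e_i * e_j).\<close>

type_synonym salg = "complex list list list"

definition blk :: "complex list list \<Rightarrow> complex list list \<Rightarrow> complex list list \<Rightarrow> complex list list
    \<Rightarrow> complex list list" where
  "blk P Q R S = map2 (@) P Q @ map2 (@) R S"

definition Z4 :: "complex list list" where
  "Z4 = [[0,0,0,0],[0,0,0,0],[0,0,0,0],[0,0,0,0]]"

definition dg4 :: "complex \<Rightarrow> complex \<Rightarrow> complex \<Rightarrow> complex \<Rightarrow> complex list list" where
  "dg4 a b c d = [[a,0,0,0],[0,b,0,0],[0,0,c,0],[0,0,0,d]]"

definition evL :: "complex list list \<Rightarrow> complex list list \<Rightarrow> complex list list" where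
  "evL P S = blk P Z4 Z4 S"

definition odL :: "complex list list \<Rightarrow> complex list list \<Rightarrow> complex list list" where
  "odL Q R = blk Z4 Q R Z4"

definition B1 :: salg where
  "B1 = [
    evL [[0,1/2,-1,1],[0,0,0,0],[0,1/2,0,0],[0,1/2,0,0]] Z4,
    evL [[1/2,0,0,-1/2],[0,0,1,1],[-1/2,0,0,1/2],[1/2,0,0,-1/2]] Z4,
    evL [[1,0,1,-1],[0,-1,0,0],[0,0,0,1],[0,0,1,0]] Z4,
    evL [[1,-1/2,-1,-1],[0,1,0,0],[0,1/2,1,0],[0,-1/2,0,1]]
        [[2,0,0,0],[-1,2,0,0],[0,0,0,1],[0,0,0,0]],
    odL [[0,0,0,1/4],[0,0,0,0],[0,0,0,-1/4],[0,0,0,1/4]]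
        [[0,0,1,1],[1,0,0,-1],[0,0,0,0],[0,0,0,0]],
    odL [[0,0,0,-1/2],[0,0,0,0],[0,0,0,0],[0,0,0,0]]
        [[0,1,0,0],[0,0,-1,1],[0,0,0,0],[0,0,0,0]],
    odL [[0,1,0,0],[0,0,0,0],[1/2,0,0,0],[1/2,0,0,0]]
        [[0,0,0,0],[0,0,0,0],[0,0,-1,1],[0,-1,0,0]],
    odL [[-1/4,1/2,0,0],[1,0,0,0],[1/4,-1/2,0,0],[-1/4,1/2,0,0]]
        [[0,0,0,0],[0,0,0,0],[-1,0,0,1],[0,0,1,1]]]"

definition B2 :: "complex \<Rightarrow> salg" where
  "B2 a = (let b = 1 + a; g = 1 - a in [
    evL [[0,0,-1,b],[0,0,0,0],[0,b/2,0,0],[0,1/2,0,0]] Z4,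
    evL [[0,0,0,0],[0,0,1,g],[-g/2,0,0,0],[1/2,0,0,0]] Z4,
    evL [[1,0,0,0],[0,-1,0,0],[0,0,a,b*g],[0,0,1,-a]] Z4,
    evL [[b,0,0,0],[0,g,0,0],[0,0,b*g,-a*b*g],[0,0,-a,1+a^2]]
        (dg4 (2-a) (2+a) a (-a)),
    odL [[0,0,0,0],[0,0,0,a*b/4],[0,0,-a*g/4,0],[0,0,a/4,0]]
        [[0,0,1,g],[1,0,0,0],[0,0,0,0],[0,0,0,0]],
    odL [[0,0,-a/2,0],[0,0,0,0],[0,0,0,-a*b/4],[0,0,0,-a/4]]
        [[0,1,0,0],[0,0,-1,b],[0,0,0,0],[0,0,0,0]],
    odL [[0,1+a/2,0,0],[0,0,0,0],[(a*g+2)/4,0,0,0],[(2-a)/4,0,0,0]]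
        [[0,0,0,0],[0,0,0,0],[0,0,-1,b],[0,-1,0,0]],
    odL [[0,0,0,0],[1-a*b/4,0,0,0],[0,(a*b-2)/4,0,0],[0,(a+2)/4,0,0]]
        [[0,0,0,0],[0,0,0,0],[-1,0,0,0],[0,0,1,g]]])"

definition B2t :: salg where
  "B2t = [
    evL [[0,0,-1,0],[0,0,0,0],[0,0,0,0],[0,1/2,0,0]]
        [[0,0,0,0],[1,0,0,0],[0,1/2,0,1],[-3/2,0,0,0]],
    evL [[0,0,0,0],[0,0,1,2],[-1,0,0,0],[1/2,0,0,0]]
        [[0,-1,0,-2],[0,0,-2,0],[0,0,0,0],[0,0,3,0]],
    evL [[1,0,0,0],[0,-1,0,0],[0,0,-1,0],[0,0,1,1]] (dg4 (-2) 0 2 0),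
    evL [[0,0,0,0],[0,2,0,0],[0,0,0,0],[0,0,1,2]] (dg4 1 1 1 1),
    odL [[0,0,0,0],[0,3/4,0,1],[0,0,0,0],[0,0,3/4,0]]
        [[0,0,-1,0],[2,0,0,0],[0,0,0,0],[-3/2,0,0,0]],
    odL [[0,0,0,0],[-3/4,0,0,0],[0,0,0,0],[0,0,0,1/4]]
        [[0,0,0,0],[0,0,-1,0],[1/2,0,0,0],[0,0,0,0]],
    odL [[0,1,0,1],[0,0,0,0],[1/2,0,0,0],[-1/4,0,0,0]]
        [[0,0,0,0],[0,-2,0,0],[0,0,1,2],[0,2,0,0]],
    odL [[0,0,-1,0],[0,0,0,0],[0,-1/2,0,0],[0,1/4,0,0]]
        [[0,-2,0,0],[0,0,0,0],[0,0,0,0],[0,0,1,2]]]"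

definition sspace :: "(nat \<Rightarrow> complex) set" where
  "sspace = {u. \<forall>k\<ge>8. u k = 0}"

definition sprod :: "salg \<Rightarrow> (nat \<Rightarrow> complex) \<Rightarrow> (nat \<Rightarrow> complex) \<Rightarrow> (nat \<Rightarrow> complex)" where
  "sprod A u v = (\<lambda>k. if k < 8 then (\<Sum>i<8. \<Sum>j<8. u i * v j * (A ! i ! k ! j)) else 0)"

definition linmap :: "(nat \<Rightarrow> nat \<Rightarrow> complex) \<Rightarrow> (nat \<Rightarrow> complex) \<Rightarrow> (nat \<Rightarrow> complex)" where
  "linmap M u = (\<lambda>k. if k < 8 then (\<Sum>j<8. M k j * u j) else 0)"

definition even_mat :: "(nat \<Rightarrow> nat \<Rightarrow> complex) \<Rightarrow> bool" where
  "even_mat M \<longleftrightarrow> (\<forall>k<8. \<forall>j<8. (k < 4) \<noteq> (j < 4) \<longrightarrow> M k j = 0)"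

definition salg_iso :: "salg \<Rightarrow> salg \<Rightarrow> (nat \<Rightarrow> nat \<Rightarrow> complex) \<Rightarrow> bool" where
  "salg_iso A B M \<longleftrightarrow> even_mat M \<and> bij_betw (linmap M) sspace sspace \<and>
     (\<forall>u\<in>sspace. \<forall>v\<in>sspace. linmap M (sprod A u v) = sprod B (linmap M u) (linmap M v))"

definition salg_isomorphic :: "salg \<Rightarrow> salg \<Rightarrow> bool" where
  "salg_isomorphic A B \<longleftrightarrow> (\<exists>M. salg_iso A B M)"

datatype fam_index = I_B1 | I_B2 complex | I_B2t

fun fam :: "fam_index \<Rightarrow> salg" where
  "fam I_B1 = B1"
| "fam (I_B2 a) = B2 a"
| "fam I_B2t = B2t"

end

theory Submission
  imports Defs
begin

text \<open>In \<open>B1\<close> and \<open>B2 a\<close> the left action of \<open>x\<^sub>1, x\<^sub>2, x\<^sub>3\<close> on the odd part vanishes,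
  while in \<open>B2t\<close> no nonzero even element acts trivially. An isomorphism between algebras of the
  first kind therefore intertwines the odd actions \<open>T\<close> of \<open>x\<^sub>4\<close> up to a scalar, which is 1 because
  \<open>tr T = 4\<close>. Now \<open>tr T\<^sup>2\<close> is 8 for \<open>B1\<close> and \<open>8 + 4a\<^sup>2\<close> for \<open>B2 a\<close>; only \<open>B1\<close> against \<open>B2 0\<close>
  (where diagonalizability of \<open>T\<close> differs) and \<open>B2 a\<close> against \<open>B2 (-a)\<close> remain. In the latter
  case the eigenvalues \<open>2-a, 2+a, a, -a\<close> force the isomorphism to swap \<open>y\<^sub>1\<close> with \<open>y\<^sub>2\<close> and \<open>y\<^sub>3\<close> with
  \<open>y\<^sub>4\<close> up to scalars, so \<open>y\<^sub>2 y\<^sub>3 = -(a/2) (y\<^sub>2 y\<^sub>3 + y\<^sub>3 y\<^sub>2)\<close> must match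
  \<open>y\<^sub>1 y\<^sub>4 = -(a(1-a)/4) (y\<^sub>1 y\<^sub>4 + y\<^sub>4 y\<^sub>1)\<close> in \<open>B2 (-a)\<close>, whence \<open>a = 0\<close> or \<open>a = -1\<close>. The case
  \<open>a = -1\<close> is excluded by the inverse isomorphism.\<close>

section \<open>Unit vectors and structure constants\<close>

definition unit_vec :: "nat \<Rightarrow> nat \<Rightarrow> complex" where
  "unit_vec j = (\<lambda>k. if k = j then 1 else 0)"

lemma unit_vec_sspace: "j < 8 \<Longrightarrow> unit_vec j \<in> sspace"
  by (auto simp: unit_vec_def sspace_def)

lemma linmap_sspace: "linmap M u \<in> sspace"
  by (auto simp: linmap_def sspace_def)

lemma sprod_sspace: "sprod A u v \<in> sspace"
  by (auto simp: sprod_def sspace_def)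

lemma linmap_unit_vec: "j < 8 \<Longrightarrow> k < 8 \<Longrightarrow> linmap M (unit_vec j) k = M k j"
  by (simp add: linmap_def unit_vec_def if_distrib cong: if_cong)

lemma sum_unit_vec: "i < 8 \<Longrightarrow> (\<Sum>j<8. unit_vec i j * f j) = f i"
  by (simp add: unit_vec_def if_distrib[of "\<lambda>x. x * _"] cong: if_cong)

lemma sprod_unit_vec:
  assumes "i < 8" "j < 8" "k < 8"
  shows "sprod A (unit_vec i) (unit_vec j) k = A ! i ! k ! j"
  using assms by (simp add: sprod_def mult.assoc sum_unit_vec sum_distrib_left[symmetric])

text \<open>Multiplicativity on pairs of basis vectors, read off in one coordinate, gives quadratic
  equations in the entries of \<open>M\<close>.\<close>

lemma salg_iso_structure_constants:
  assumes "salg_iso A B M" "i < 8" "j < 8" "k < 8"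
  shows "(\<Sum>l<8. M k l * A ! i ! l ! j) = (\<Sum>p<8. \<Sum>q<8. M p i * M q j * B ! p ! k ! q)"
proof -
  have "linmap M (sprod A (unit_vec i) (unit_vec j)) k
      = sprod B (linmap M (unit_vec i)) (linmap M (unit_vec j)) k"
    using assms unit_vec_sspace by (auto simp: salg_iso_def)
  then show ?thesis
    using assms by (simp add: linmap_def[of M "sprod _ _ _"] sprod_def[of B]
        linmap_unit_vec sprod_unit_vec cong: sum.cong_simp)
qed

section \<open>The inverse isomorphism\<close>

lemma linmap_inverse:
  assumes N: "\<And>j. j < 8 \<Longrightarrow> linmap M (\<lambda>k. N k j) = unit_vec j" and u: "u \<in> sspace"
  shows "linmap M (linmap N u) = u"
proof
  fix k
  show "linmap M (linmap N u) k = u k"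
  proof (cases "k < 8")
    case True
    have "linmap M (linmap N u) k = (\<Sum>l<8. \<Sum>j<8. M k l * N l j * u j)"
      using True by (simp add: linmap_def sum_distrib_left mult.assoc)
    also have "\<dots> = (\<Sum>j<8. linmap M (\<lambda>k. N k j) k * u j)"
      using True by (subst sum.swap) (simp add: linmap_def sum_distrib_right)
    also have "\<dots> = (\<Sum>j<8. if j = k then u j else 0)"
      by (rule sum.cong) (auto simp: N unit_vec_def)
    finally show ?thesis using True by simp
  qed (use u in \<open>auto simp: linmap_def sspace_def\<close>)
qed

text \<open>The columns of \<open>N\<close> are the preimages of the unit vectors under
  \<open>linmap M\<close>; injectivity makes this right inverse two-sided.\<close>

lemma salg_iso_inverse:
  assumes iso: "salg_iso A B M"
  obtains N where "salg_iso B A N"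
    "\<forall>i<8. \<forall>j<8. (\<Sum>k<8. M i k * N k j) = (if i = j then 1 else 0)"
    "\<forall>i<8. \<forall>j<8. (\<Sum>k<8. N i k * M k j) = (if i = j then 1 else 0)"
proof -
  have ev: "even_mat M" and bij: "bij_betw (linmap M) sspace sspace"
    and hom: "\<And>u v. u \<in> sspace \<Longrightarrow> v \<in> sspace \<Longrightarrow>
      linmap M (sprod A u v) = sprod B (linmap M u) (linmap M v)"
    using iso by (auto simp: salg_iso_def)
  have inj: "inj_on (linmap M) sspace" using bij by (simp add: bij_betw_def)
  define N where "N = (\<lambda>k j. inv_into sspace (linmap M) (unit_vec j) k)"
  have img: "unit_vec j \<in> linmap M ` sspace" if "j < 8" for j
    using bij that by (simp add: bij_betw_def unit_vec_sspace)
  have N: "linmap M (\<lambda>k. N k j) = unit_vec j" if "j < 8" for j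
    using f_inv_into_f[OF img[OF that]] by (simp add: N_def)
  have Nss: "(\<lambda>k. N k j) \<in> sspace" if "j < 8" for j
    using inv_into_into[OF img[OF that]] by (simp add: N_def)
  have MN: "linmap M (linmap N u) = u" if "u \<in> sspace" for u
    using linmap_inverse[of M N, OF N that] .
  have NM: "linmap N (linmap M u) = u" if "u \<in> sspace" for u
    using inj MN[OF linmap_sspace] that linmap_sspace by (meson inj_onD)
  have "bij_betw (linmap N) sspace sspace"
    by (rule bij_betw_byWitness[where f' = "linmap M"]) (auto simp: MN NM linmap_sspace)
  moreover have "linmap N (sprod B u v) = sprod A (linmap N u) (linmap N v)"
    if "u \<in> sspace" "v \<in> sspace" for u v
    using hom[OF linmap_sspace linmap_sspace, of N u N v] that NM[OF sprod_sspace] MN by metis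
  moreover have "even_mat N"
    unfolding even_mat_def
  proof (intro allI impI)
    have M0: "M k l = 0" if "k < 8" "l < 8" "(k < 4) \<noteq> (l < 4)" for k l
      using ev that by (auto simp: even_mat_def)
    fix k j :: nat assume k: "k < 8" and j: "j < 8" and kj: "(k < 4) \<noteq> (j < 4)"
    \<comment> \<open>the component of parity opposite to \<open>j\<close> of the \<open>j\<close>-th column is mapped to 0\<close>
    define w where "w = (\<lambda>l. if (l < 4) \<noteq> (j < 4) then N l j else 0)"
    have "linmap M w i = 0" for i
    proof (cases "i < 8 \<and> (i < 4) \<noteq> (j < 4)")
      case True
      then have "M i l * w l = M i l * N l j" if "l < 8" for l
        using M0[of i l] that by (cases "(l < 4) = (j < 4)") (auto simp: w_def)
      then have "(\<Sum>l<8. M i l * w l) = (\<Sum>l<8. M i l * N l j)"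
        by (intro sum.cong refl) simp
      then have "linmap M w i = linmap M (\<lambda>k. N k j) i"
        using True by (simp add: linmap_def)
      then show ?thesis using True by (auto simp: N[OF j] unit_vec_def)
    next
      case False
      then show ?thesis
        using M0 j by (auto simp: linmap_def w_def intro!: sum.neutral)
    qed
    then have "linmap M w = linmap M (\<lambda>_. 0)" by (auto simp: linmap_def)
    moreover have "w \<in> sspace" using Nss[OF j] by (auto simp: w_def sspace_def)
    ultimately have "w = (\<lambda>_. 0)" using inj by (auto simp: sspace_def dest: inj_onD)
    then show "N k j = 0" using kj by (metis w_def)
  qed
  ultimately have "salg_iso B A N" by (simp add: salg_iso_def)
  moreover have "(\<Sum>k<8. M i k * N k j) = (if i = j then 1 else 0)" if "i < 8" "j < 8" for i j
    using fun_cong[OF N[OF that(2)], of i] that by (simp add: linmap_def unit_vec_def)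
  moreover have "(\<Sum>k<8. N i k * M k j) = (if i = j then 1 else 0)" if "i < 8" "j < 8" for i j
    using fun_cong[OF NM[OF unit_vec_sspace[OF that(2)]], of i] that
    by (simp add: linmap_def[of N] linmap_unit_vec cong: sum.cong_simp) (simp add: unit_vec_def)
  ultimately show ?thesis using that by blast
qed

lemma salg_iso_column_nonzero:
  assumes iso: "salg_iso A B M" and j: "j < 8"
  shows "\<exists>k<8. (k < 4 \<longleftrightarrow> j < 4) \<and> M k j \<noteq> 0"
proof (rule ccontr)
  assume "\<not> ?thesis"
  then have "M k j = 0" if "k < 8" for k
    using iso j that by (auto simp: salg_iso_def even_mat_def)
  then have "linmap M (unit_vec j) = linmap M (\<lambda>_. 0)"
    by (simp add: linmap_def fun_eq_iff unit_vec_def if_distrib j cong: if_cong)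
  then have "unit_vec j = (\<lambda>_. 0)"
    using iso unit_vec_sspace[OF j] by (auto simp: salg_iso_def bij_betw_def sspace_def dest: inj_onD)
  then show False by (metis unit_vec_def zero_neq_one)
qed

section \<open>Restriction to the even and odd blocks\<close>

lemma sum_odd:
  fixes f :: "nat \<Rightarrow> complex"
  assumes "\<And>k. k < 4 \<Longrightarrow> f k = 0"
  shows "(\<Sum>k<8. f k) = (\<Sum>k=4..<8. f k)"
  by (rule sum.mono_neutral_right) (auto simp: assms)

lemma sum_even:
  fixes f :: "nat \<Rightarrow> complex"
  assumes "\<And>k. 4 \<le> k \<Longrightarrow> k < 8 \<Longrightarrow> f k = 0"
  shows "(\<Sum>k<8. f k) = (\<Sum>k<4. f k)"
  by (rule sum.mono_neutral_right) (auto simp: assms)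

lemma salg_iso_even_matD: "salg_iso A B M \<Longrightarrow> k < 8 \<Longrightarrow> j < 8 \<Longrightarrow> (k < 4) \<noteq> (j < 4) \<Longrightarrow> M k j = 0"
  by (auto simp: salg_iso_def even_mat_def)

lemma salg_iso_sum_odd_odd:
  assumes iso: "salg_iso A B M" and "4 \<le> i" "i < 8" "4 \<le> j" "j < 8" "k < 4"
  shows "(\<Sum>l<8. M k l * A ! i ! l ! j)
    = (\<Sum>p=4..<8. \<Sum>q=4..<8. M p i * M q j * B ! p ! k ! q)"
  using assms salg_iso_structure_constants[OF iso, of i j k]
  by (simp add: sum_odd salg_iso_even_matD)

text \<open>The inverse matrix is even as well, so the odd blocks are already inverse to each
  other.\<close>

lemma salg_iso_odd_inverse:
  assumes iso: "salg_iso A B M"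
  obtains N where
    "\<forall>i\<in>{4..<8}. \<forall>j\<in>{4..<8}. (\<Sum>k=4..<8. M i k * N k j) = (if i = j then 1 else 0)"
    "\<forall>i\<in>{4..<8}. \<forall>j\<in>{4..<8}. (\<Sum>k=4..<8. N i k * M k j) = (if i = j then 1 else 0)"
proof -
  obtain N where N: "salg_iso B A N"
    "\<forall>i<8. \<forall>j<8. (\<Sum>k<8. M i k * N k j) = (if i = j then 1 else 0)"
    "\<forall>i<8. \<forall>j<8. (\<Sum>k<8. N i k * M k j) = (if i = j then 1 else 0)"
    by (rule salg_iso_inverse[OF iso]) (rule that)
  show ?thesis
  proof (rule that[of N]; intro ballI)
    fix i j :: nat assume "i \<in> {4..<8}" "j \<in> {4..<8}"
    then show "(\<Sum>k=4..<8. M i k * N k j) = (if i = j then 1 else 0)"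
      using N(2)[rule_format, of i j] iso by (simp add: sum_odd salg_iso_even_matD)
  next
    fix i j :: nat assume "i \<in> {4..<8}" "j \<in> {4..<8}"
    then show "(\<Sum>k=4..<8. N i k * M k j) = (if i = j then 1 else 0)"
      using N(3)[rule_format, of i j] N(1) by (simp add: sum_odd salg_iso_even_matD)
  qed
qed

text \<open>On odd blocks this is \<open>M L(x) = L'(M x) M\<close> for an even basis vector
  \<open>x\<close>; the inner sum over \<open>p\<close> is the matrix of
  \<open>L'(M x)\<close>.\<close>

lemma salg_iso_sum_even_odd:
  assumes iso: "salg_iso A B M" and i: "i < 4" and jk: "j \<in> {4..<8}" "k \<in> {4..<8}"
  shows "(\<Sum>l=4..<8. M k l * A ! i ! l ! j)
    = (\<Sum>q=4..<8. (\<Sum>p<4. M p i * B ! p ! k ! q) * M q j)"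
proof -
  have "(\<Sum>l=4..<8. M k l * A ! i ! l ! j) = (\<Sum>l<8. M k l * A ! i ! l ! j)"
    by (rule sum_odd[symmetric]) (use iso jk in \<open>auto simp: salg_iso_even_matD\<close>)
  also have "\<dots> = (\<Sum>p<8. \<Sum>q<8. M p i * M q j * B ! p ! k ! q)"
    by (rule salg_iso_structure_constants[OF iso]) (use i jk in auto)
  also have "\<dots> = (\<Sum>p<4. \<Sum>q<8. M p i * M q j * B ! p ! k ! q)"
    by (rule sum_even) (use i in \<open>simp add: salg_iso_even_matD[OF iso]\<close>)
  also have "\<dots> = (\<Sum>p<4. \<Sum>q=4..<8. M p i * M q j * B ! p ! k ! q)"
    by (rule sum.cong[OF refl], rule sum_odd) (use jk in \<open>simp add: salg_iso_even_matD[OF iso]\<close>)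
  also have "\<dots> = (\<Sum>q=4..<8. (\<Sum>p<4. M p i * B ! p ! k ! q) * M q j)"
    by (subst sum.swap, simp only: sum_distrib_right) (simp only: mult_ac)
  finally show ?thesis .
qed

text \<open>If \<open>L(x)\<close> vanishes on the odd part, then \<open>L'(M x) M = 0\<close>
  there, and multiplying by the inverse of the odd block from the right gives
  \<open>L'(M x) = 0\<close>.\<close>

lemma salg_iso_odd_annihilator:
  assumes iso: "salg_iso A B M" and i: "i < 4" and k: "k \<in> {4..<8}" and r: "r \<in> {4..<8}"
    and zero: "\<And>l j. l \<in> {4..<8} \<Longrightarrow> j \<in> {4..<8} \<Longrightarrow> A ! i ! l ! j = 0"
  shows "(\<Sum>p<4. M p i * B ! p ! k ! r) = 0"
proof -
  obtain N where N: "\<forall>i\<in>{4..<8}. \<forall>j\<in>{4..<8}. (\<Sum>k=4..<8. M i k * N k j) = (if i = j then 1 else 0)"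
    by (rule salg_iso_odd_inverse[OF iso]) (rule that)
  define c where "c = (\<lambda>q. \<Sum>p<4. M p i * B ! p ! k ! q)"
  have c: "(\<Sum>q=4..<8. c q * M q j) = 0" if "j \<in> {4..<8}" for j
    using salg_iso_sum_even_odd[OF iso i that k] zero that by (simp add: c_def)
  have "c r = (\<Sum>q=4..<8. if q = r then c q else 0)"
    using r by simp
  also have "\<dots> = (\<Sum>q=4..<8. c q * (\<Sum>j=4..<8. M q j * N j r))"
    by (rule sum.cong) (use N r in auto)
  also have "\<dots> = (\<Sum>j=4..<8. (\<Sum>q=4..<8. c q * M q j) * N j r)"
    unfolding sum_distrib_left sum_distrib_right by (subst sum.swap) (simp add: mult.assoc)
  also have "\<dots> = 0"
    by (simp add: c)
  finally show ?thesis by (simp add: c_def)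
qed

section \<open>Traces of intertwined matrices\<close>

text \<open>\<open>tr T = tr (N M T) = tr (N T' M) = tr (T' M N) = tr T'\<close>.\<close>

lemma trace_intertwined:
  fixes T T' M N :: "nat \<Rightarrow> nat \<Rightarrow> complex"
  assumes "finite I"
    and inter: "\<And>k j. k \<in> I \<Longrightarrow> j \<in> I \<Longrightarrow> (\<Sum>l\<in>I. M k l * T l j) = (\<Sum>l\<in>I. T' k l * M l j)"
    and MN: "\<And>i j. i \<in> I \<Longrightarrow> j \<in> I \<Longrightarrow> (\<Sum>k\<in>I. M i k * N k j) = (if i = j then 1 else 0)"
    and NM: "\<And>i j. i \<in> I \<Longrightarrow> j \<in> I \<Longrightarrow> (\<Sum>k\<in>I. N i k * M k j) = (if i = j then 1 else 0)"
  shows "(\<Sum>j\<in>I. T j j) = (\<Sum>k\<in>I. T' k k)"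
proof -
  have "(\<Sum>j\<in>I. \<Sum>k\<in>I. N j k * (\<Sum>l\<in>I. M k l * T l j))
      = (\<Sum>j\<in>I. \<Sum>k\<in>I. \<Sum>l\<in>I. N j k * M k l * T l j)"
    by (simp add: sum_distrib_left mult.assoc)
  also have "\<dots> = (\<Sum>j\<in>I. \<Sum>l\<in>I. (\<Sum>k\<in>I. N j k * M k l) * T l j)"
    by (rule sum.cong[OF refl], subst sum.swap) (simp add: sum_distrib_right)
  also have "\<dots> = (\<Sum>j\<in>I. \<Sum>l\<in>I. if j = l then T l j else 0)"
    by (intro sum.cong refl) (simp add: NM)
  also have "\<dots> = (\<Sum>j\<in>I. T j j)"
    using \<open>finite I\<close> by simp
  finally have 1: "(\<Sum>j\<in>I. T j j) = (\<Sum>j\<in>I. \<Sum>k\<in>I. N j k * (\<Sum>l\<in>I. T' k l * M l j))"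
    by (simp add: inter cong: sum.cong_simp)
  also have "\<dots> = (\<Sum>k\<in>I. \<Sum>j\<in>I. \<Sum>l\<in>I. T' k l * (M l j * N j k))"
    by (subst sum.swap) (simp add: sum_distrib_left mult_ac)
  also have "\<dots> = (\<Sum>k\<in>I. \<Sum>l\<in>I. T' k l * (\<Sum>j\<in>I. M l j * N j k))"
    by (rule sum.cong[OF refl], subst sum.swap) (simp add: sum_distrib_left)
  also have "\<dots> = (\<Sum>k\<in>I. \<Sum>l\<in>I. if k = l then T' k l else 0)"
    by (intro sum.cong refl) (simp add: MN)
  also have "\<dots> = (\<Sum>k\<in>I. T' k k)"
    using \<open>finite I\<close> by simp
  finally show ?thesis .
qed

text \<open>\<open>M T T = T' M T = T' T' M\<close>.\<close>

lemma square_intertwined: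
  fixes T T' M :: "nat \<Rightarrow> nat \<Rightarrow> complex"
  assumes inter: "\<And>k j. k \<in> I \<Longrightarrow> j \<in> I \<Longrightarrow> (\<Sum>l\<in>I. M k l * T l j) = (\<Sum>l\<in>I. T' k l * M l j)"
    and "k \<in> I" "j \<in> I"
  shows "(\<Sum>l\<in>I. M k l * (\<Sum>i\<in>I. T l i * T i j)) = (\<Sum>l\<in>I. (\<Sum>i\<in>I. T' k i * T' i l) * M l j)"
proof -
  have "(\<Sum>l\<in>I. M k l * (\<Sum>i\<in>I. T l i * T i j)) = (\<Sum>i\<in>I. (\<Sum>l\<in>I. M k l * T l i) * T i j)"
    by (simp add: sum_distrib_left sum_distrib_right mult.assoc) (rule sum.swap)
  also have "\<dots> = (\<Sum>i\<in>I. (\<Sum>l\<in>I. T' k l * M l i) * T i j)"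
    using assms by (simp cong: sum.cong_simp)
  also have "\<dots> = (\<Sum>l\<in>I. T' k l * (\<Sum>i\<in>I. M l i * T i j))"
    by (simp add: sum_distrib_left sum_distrib_right mult.assoc) (rule sum.swap)
  also have "\<dots> = (\<Sum>l\<in>I. T' k l * (\<Sum>i\<in>I. T' l i * M i j))"
    using assms by (simp cong: sum.cong_simp)
  also have "\<dots> = (\<Sum>i\<in>I. (\<Sum>l\<in>I. T' k l * T' l i) * M i j)"
    by (simp add: sum_distrib_left sum_distrib_right mult.assoc) (rule sum.swap)
  finally show ?thesis .
qed

section \<open>The odd action of the fourth even basis vector\<close>

text \<open>The common feature of \<open>B1\<close> and all \<open>B2 a\<close>; the nonzero trace
  fixes the scale of the action.\<close>

definition x4_acts_odd :: "salg \<Rightarrow> bool" where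
  "x4_acts_odd A \<longleftrightarrow>
    (\<forall>i\<in>{..<3}. \<forall>k\<in>{4..<8}. \<forall>j\<in>{4..<8}. A ! i ! k ! j = 0) \<and> (\<Sum>j=4..<8. A ! 3 ! j ! j) = 4"

lemma index_sets:
  "{..<3::nat} = {0,1,2}" "{..<4::nat} = {0,1,2,3}" "{4..<8::nat} = {4,5,6,7}"
  by auto

lemmas B1_entries = B1_def evL_def odL_def blk_def Z4_def dg4_def
lemmas B2_entries = B2_def Let_def evL_def odL_def blk_def Z4_def dg4_def
lemmas B2t_entries = B2t_def evL_def odL_def blk_def Z4_def dg4_def

lemma x4_acts_odd_B1: "x4_acts_odd B1"
  by (simp add: x4_acts_odd_def index_sets B1_entries)

lemma x4_acts_odd_B2: "x4_acts_odd (B2 a)"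
  by (simp add: x4_acts_odd_def index_sets B2_entries)

lemma not_salg_iso_B2t:
  assumes "x4_acts_odd A"
  shows "\<not> salg_iso A B2t M"
proof
  assume iso: "salg_iso A B2t M"
  have eq: "(\<Sum>p<4. M p 0 * B2t ! p ! k ! r) = 0" if "k \<in> {4..<8}" "r \<in> {4..<8}" for k r
    by (rule salg_iso_odd_annihilator[OF iso]) (use assms that in \<open>auto simp: x4_acts_odd_def\<close>)
  \<comment> \<open>These matrix entries each isolate one coordinate of the image of the first basis
    vector; only the entry (4,4) also involves \<open>M 3 0\<close>, which is already zero.\<close>
  have "M 3 0 = 0"
    using eq[of 5 5] by (simp add: index_sets B2t_entries)
  moreover have "M 2 0 = 0"
    using eq[of 4 4] calculation by (simp add: index_sets B2t_entries)
  moreover have "M 1 0 = 0"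
    using eq[of 4 5] by (simp add: index_sets B2t_entries)
  moreover have "M 0 0 = 0"
    using eq[of 5 4] by (simp add: index_sets B2t_entries)
  ultimately have "\<forall>k\<in>{..<4}. M k 0 = 0"
    by (simp add: index_sets)
  then show False
    using salg_iso_column_nonzero[OF iso, of 0] by auto
qed

text \<open>The first three even basis vectors kill the odd part of \<open>B\<close>, so the image
  of the fourth acts there as \<open>M 3 3\<close> times the fourth; comparing traces gives
  \<open>4 = M 3 3 * 4\<close>.\<close>

lemma salg_iso_intertwines_x4:
  assumes iso: "salg_iso A B M" and A: "x4_acts_odd A" and B: "x4_acts_odd B"
  defines "I \<equiv> {4..<8}"
  shows "\<And>k j. k \<in> I \<Longrightarrow> j \<in> I \<Longrightarrow>
           (\<Sum>l\<in>I. M k l * A ! 3 ! l ! j) = (\<Sum>l\<in>I. B ! 3 ! k ! l * M l j)"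
    and "(\<Sum>j\<in>I. \<Sum>i\<in>I. A ! 3 ! j ! i * A ! 3 ! i ! j) = (\<Sum>j\<in>I. \<Sum>i\<in>I. B ! 3 ! j ! i * B ! 3 ! i ! j)"
proof -
  obtain N where
    MN: "\<forall>i\<in>I. \<forall>j\<in>I. (\<Sum>k\<in>I. M i k * N k j) = (if i = j then 1 else 0)" and
    NM: "\<forall>i\<in>I. \<forall>j\<in>I. (\<Sum>k\<in>I. N i k * M k j) = (if i = j then 1 else 0)"
    by (rule salg_iso_odd_inverse[OF iso]) (rule that; simp add: I_def)
  have fin: "finite I" by (simp add: I_def)
  have inter: "(\<Sum>l\<in>I. M k l * A ! 3 ! l ! j) = (\<Sum>l\<in>I. M 3 3 * B ! 3 ! k ! l * M l j)"
    if kj: "k \<in> I" "j \<in> I" for k j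
  proof -
    have "(\<Sum>p<4. M p 3 * B ! p ! k ! q) = M 3 3 * B ! 3 ! k ! q" if "q \<in> I" for q
    proof -
      have "B ! p ! k ! q = 0" if "p < 3" for p
        using B kj that \<open>q \<in> I\<close> by (auto simp: x4_acts_odd_def I_def)
      then show ?thesis by (simp add: index_sets)
    qed
    then show ?thesis
      using salg_iso_sum_even_odd[OF iso _ kj(2)[unfolded I_def] kj(1)[unfolded I_def], of 3]
      by (simp add: I_def)
  qed
  have "(\<Sum>j\<in>I. A ! 3 ! j ! j) = (\<Sum>k\<in>I. M 3 3 * B ! 3 ! k ! k)"
    by (rule trace_intertwined[OF fin inter MN[rule_format] NM[rule_format]])
  then have "4 = M 3 3 * 4"
    using A B unfolding x4_acts_odd_def I_def by (metis sum_distrib_left)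
  then have "M 3 3 = 1" by simp
  then show *: "(\<Sum>l\<in>I. M k l * A ! 3 ! l ! j) = (\<Sum>l\<in>I. B ! 3 ! k ! l * M l j)"
    if "k \<in> I" "j \<in> I" for k j
    using inter[OF that] by simp
  show "(\<Sum>j\<in>I. \<Sum>i\<in>I. A ! 3 ! j ! i * A ! 3 ! i ! j) = (\<Sum>j\<in>I. \<Sum>i\<in>I. B ! 3 ! j ! i * B ! 3 ! i ! j)"
    by (rule trace_intertwined[OF fin square_intertwined[of I M, OF *] MN[rule_format] NM[rule_format]])
qed

section \<open>Separating \<open>B1\<close> and the members of the family \<open>B2\<close>\<close>

lemma trace_square_B2: "(\<Sum>j=4..<8. \<Sum>i=4..<8. B2 a ! 3 ! j ! i * B2 a ! 3 ! i ! j) = 8 + 4 * a^2"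
  by (simp add: index_sets B2_entries) (simp add: algebra_simps power2_eq_square)

lemma trace_square_B1: "(\<Sum>j=4..<8. \<Sum>i=4..<8. B1 ! 3 ! j ! i * B1 ! 3 ! i ! j) = 8"
  by (simp add: index_sets B1_entries)

lemma not_salg_iso_B1_B2: "\<not> salg_iso B1 (B2 a) M"
proof
  assume iso: "salg_iso B1 (B2 a) M"
  note inter = salg_iso_intertwines_x4[OF iso x4_acts_odd_B1 x4_acts_odd_B2]
  have "a = 0"
    using inter(2) unfolding trace_square_B1 trace_square_B2 by simp
  \<comment> \<open>\<open>(T - 2) y\<^sub>1 = - y\<^sub>2\<close> in \<open>B1\<close>, whereas \<open>T (T - 2) = 0\<close> in \<open>B2 0\<close>, so \<open>y\<^sub>2\<close> would map to 0\<close>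
  have "M k 5 = 0" if "k \<in> {4..<8}" for k
    using that inter(1)[of k 4] inter(1)[of k 5]
    by (simp add: index_sets \<open>a = 0\<close>, elim disjE) (simp_all add: index_sets B1_entries B2_entries)
  then show False
    using salg_iso_column_nonzero[OF iso, of 5] by auto
qed

lemma not_salg_iso_B2_minus:
  assumes "a \<noteq> 0" "a \<noteq> -1"
  shows "\<not> salg_iso (B2 a) (B2 (- a)) M"
proof
  assume iso: "salg_iso (B2 a) (B2 (- a)) M"
  \<comment> \<open>Both odd actions are diagonal, so intertwining reads
    \<open>c * M k j = 0\<close> with \<open>c\<close> the difference of the two
    eigenvalues.\<close>
  have eig: "M k j = 0" if "c \<noteq> 0" "c = B2 a ! 3 ! j ! j - B2 (- a) ! 3 ! k ! k"
    "k \<in> {4..<8}" "j \<in> {4..<8}" for k j c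
  proof -
    have diagonal: "B2 b ! 3 ! p ! q = 0"
      if "p \<noteq> q" "p \<in> {4..<8}" "q \<in> {4..<8}" for b p q
      using that by (auto simp: index_sets B2_entries)
    have "(\<Sum>l=4..<8. M k l * B2 a ! 3 ! l ! j)
        = (\<Sum>l=4..<8. if l = j then M k l * B2 a ! 3 ! l ! l else 0)"
      by (intro sum.cong refl) (use diagonal that(4) in auto)
    moreover have "(\<Sum>l=4..<8. B2 (- a) ! 3 ! k ! l * M l j)
        = (\<Sum>l=4..<8. if k = l then B2 (- a) ! 3 ! k ! k * M l j else 0)"
      by (intro sum.cong refl) (use diagonal that(3) in auto)
    ultimately have "M k j * B2 a ! 3 ! j ! j = B2 (- a) ! 3 ! k ! k * M k j"
      using salg_iso_intertwines_x4(1)[OF iso x4_acts_odd_B2 x4_acts_odd_B2 that(3,4)] that(3,4)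
      by (simp add: mult.commute)
    then have "c * M k j = 0"
      unfolding that(2) by (simp add: left_diff_distrib mult.commute)
    then show ?thesis using that(1) by simp
  qed
  have "a + 1 \<noteq> 0" using assms(2) by (simp add: eq_neg_iff_add_eq_0)
  have diag: "M 4 4 = 0" "M 5 5 = 0" "M 6 6 = 0" "M 7 7 = 0"
    by (rule eig[where c = "- 2 * a"] eig[where c = "2 * a"]; use \<open>a \<noteq> 0\<close> in \<open>simp add: B2_entries\<close>)+
  have offdiag: "M 6 4 = 0" "M 4 6 = 0" "M 5 7 = 0" "M 7 5 = 0"
    by (rule eig[where c = 2] eig[where c = "-2"]; simp add: B2_entries)+
  have "2 + a * 2 = 2 * (a + 1)" by simp
  then have "2 + a * 2 \<noteq> 0" using \<open>a + 1 \<noteq> 0\<close> by (metis mult_eq_0_iff zero_neq_numeral)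
  \<comment> \<open>Here the eigenvalues differ by \<open>2 * (a + 1)\<close> up to sign, so
    \<open>a\<close> different from -1 is essential.\<close>
  then have collide: "M 6 5 = 0" "M 4 7 = 0"
    using eig[of "2 * (a + 1)" 5 6] eig[of "- 2 * (a + 1)" 7 4] assms(2)
    by (simp_all add: index_sets B2_entries algebra_simps)
  note zeros = diag offdiag collide
  have nonzero: "\<exists>k\<in>{4..<8}. M k j \<noteq> 0" if "j \<in> {4..<8}" for j
    using salg_iso_column_nonzero[OF iso, of j] that by auto
  have M45: "M 4 5 \<noteq> 0" and M67: "M 6 7 \<noteq> 0"
    using nonzero[of 5] nonzero[of 7] by (simp_all add: index_sets zeros)
  note prod = salg_iso_sum_odd_odd[OF iso]
  have index8: "{..<8::nat} = {0,1,2,3,4,5,6,7}" by auto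
  note simps = index8 index_sets B2_entries zeros
  \<comment> \<open>Entries surviving only when eigenvalues collide (\<open>a = 1\<close>) are killed by
    \<open>y\<^sub>1 y\<^sub>2 = y\<^sub>2 y\<^sub>1 = 0\<close> and \<open>y\<^sub>3 y\<^sub>4 = y\<^sub>4 y\<^sub>3 = 0\<close>.\<close>
  have "M 7 4 = 0"
    using prod[of 4 5 1] prod[of 5 4 1] M45 assms by (auto simp: simps)
  moreover have "M 5 6 = 0"
    using prod[of 6 7 0] prod[of 7 6 0] M67 assms by (auto simp: simps)
  ultimately have M76: "M 7 6 \<noteq> 0"
    using nonzero[of 6] by (simp add: index_sets zeros)
  \<comment> \<open>The images of the second and third odd basis vectors are now multiples of the
    first and fourth; \<open>x\<close> is the product of the two scalars.\<close>
  define x where "x = M 4 5 * M 7 6"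
  \<comment> \<open>Product of the second and third odd basis vectors, with the common factor
    \<open>- a / 4\<close> cancelled; the reversed product gives the second equation for
    \<open>M 1 0\<close> below.\<close>
  have "2 * M 1 0 = x * (1 - a)"
    using prod[of 5 6 1] assms \<open>M 5 6 = 0\<close> by (simp add: simps x_def)
  then have m: "M 1 0 = x * (1 - a) / 2" by (simp add: field_simps)
  have "M 1 0 * (1 + a / 2) = x * (1 + a * (1 - a) / 4)"
    using prod[of 6 5 1] \<open>M 5 6 = 0\<close> by (simp add: simps x_def)
  moreover have "x * (1 - a) / 2 * (1 + a / 2) - x * (1 + a * (1 - a) / 4) = - (x * (a + 1)) / 2"
    by (simp add: field_simps)
  ultimately have "- (x * (a + 1)) / 2 = 0"
    unfolding m by (metis diff_self)
  then show False
    using M45 M76 \<open>a + 1 \<noteq> 0\<close> by (simp add: x_def)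
qed

section \<open>Pairwise nonisomorphism\<close>

theorem theorem3p6:
  shows "\<forall>s t. s \<noteq> t \<longrightarrow> \<not> salg_isomorphic (fam s) (fam t)"
proof (intro allI impI notI)
  have sym: "salg_isomorphic B A" if iso: "salg_isomorphic A B" for A B
  proof -
    obtain M where "salg_iso A B M" using iso by (auto simp: salg_isomorphic_def)
    then obtain N where "salg_iso B A N" by (rule salg_iso_inverse)
    then show ?thesis by (auto simp: salg_isomorphic_def)
  qed
  have B2t: "\<not> salg_isomorphic A B2t" "\<not> salg_isomorphic B2t A" if "x4_acts_odd A" for A
    using not_salg_iso_B2t[OF that] sym[of B2t A] by (auto simp: salg_isomorphic_def)
  have B1: "\<not> salg_isomorphic B1 (B2 a)" "\<not> salg_isomorphic (B2 a) B1" for a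
    using not_salg_iso_B1_B2 sym[of "B2 a" B1] by (auto simp: salg_isomorphic_def)
  have B2: "\<not> salg_isomorphic (B2 a) (B2 b)" if "a \<noteq> b" for a b
  proof
    assume iso: "salg_isomorphic (B2 a) (B2 b)"
    then obtain M where M: "salg_iso (B2 a) (B2 b) M" by (auto simp: salg_isomorphic_def)
    have "a^2 = b^2"
      using salg_iso_intertwines_x4(2)[OF M x4_acts_odd_B2 x4_acts_odd_B2]
      unfolding trace_square_B2 by simp
    with that have b: "b = - a" and "a \<noteq> 0" by (auto simp: power2_eq_iff)
    show False
    proof (cases "a = -1")
      \<comment> \<open>The inverse goes from \<open>B2 1\<close> to \<open>B2 (-1)\<close>, and the
        parameter 1 is neither 0 nor -1.\<close>
      case True
      then show ?thesis
        using sym[OF iso] not_salg_iso_B2_minus[of 1] b by (auto simp: salg_isomorphic_def)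
    next
      case False
      then show ?thesis
        using M b \<open>a \<noteq> 0\<close> not_salg_iso_B2_minus by blast
    qed
  qed
  fix s t assume "s \<noteq> t" "salg_isomorphic (fam s) (fam t)"
  then show False
    using B1 B2 B2t[OF x4_acts_odd_B1] B2t[OF x4_acts_odd_B2] by (cases s; cases t) auto
qed

end
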